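(* Let $Y\in\mathbb R^{d\times n}$. Let $b_1,\dots,b_r$ be its distinct columns, with multiplicities $m_1,\dots,m_r$, and put $m=(m_1,\dots,m_r)$. Define $$T=\sum_{t=1}^r m_tb_t,\qquad S=\Bigl\{s\in\mathbb Z^r:0\le s_t\le m_t\ (1\le t\le r),\ \sum_{t=1}^r s_tb_t=T/2\Bigr\},$$ $$\mathcal A=\{t:\text{there exists }s\in S\text{ with }0<s_t<m_t\},\qquad Q=\operatorname{span}\{m-2s:s\in S\}.$$ Then $$\sigma(Y)=\sum_{t\in\mathcal A}(m_t-1)+\dim Q.$$ In particular, the sign vectors in $\ker Y$ span $\ker Y$ if and only if (i) every $t$ with $m_t\ge2$ belongs to $\mathcal A$; and (ii) $Q=\{z\in\mathbb R^r:\sum_{t}z_tb_t=0\}$.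
   Context: For a real matrix $Y$ with $n$ columns, $\sigma(Y)=\dim\operatorname{span}(\ker Y\cap\{-1,1\}^n)$, where span is the real linear span and $\operatorname{span}\varnothing=\{0\}$. Sign vectors are vectors with entries in $\{-1,1\}$. *)

theory Defs
  imports "HOL-Analysis.Analysis"
begin

definition kernel :: "real ^ 'n ^ 'd \<Rightarrow> (real ^ 'n) set" where
  "kernel Y = {x. Y *v x = 0}"

definition sign_vectors :: "(real ^ 'n) set" where
  "sign_vectors = {x. \<forall>j. x $ j \<in> {-1, 1}}"

definition sigma :: "real ^ 'n ^ 'd \<Rightarrow> nat" where
  "sigma Y = dim (span (kernel Y \<inter> sign_vectors))"

text \<open>In the definitions below, \<open>b\<close> enumerates the distinct columns of \<open>Y\<close> without repetition.
  Their number \<open>r\<close> is the cardinality of the index type \<open>'r\<close>.\<close>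

definition enumerates_columns :: "real ^ 'n ^ 'd \<Rightarrow> ('r::finite \<Rightarrow> real ^ 'd) \<Rightarrow> bool" where
  "enumerates_columns Y b \<longleftrightarrow> bij_betw b UNIV (columns Y)"

definition mult :: "real ^ 'n ^ 'd \<Rightarrow> ('r::finite \<Rightarrow> real ^ 'd) \<Rightarrow> int ^ 'r" where
  "mult Y b = (\<chi> t. int (card {j. column j Y = b t}))"

definition col_total :: "real ^ 'n ^ 'd \<Rightarrow> ('r::finite \<Rightarrow> real ^ 'd) \<Rightarrow> real ^ 'd" where
  "col_total Y b = (\<Sum>t\<in>UNIV. of_int (mult Y b $ t) *\<^sub>R b t)"

definition half_solutions :: "real ^ 'n ^ 'd \<Rightarrow> ('r::finite \<Rightarrow> real ^ 'd) \<Rightarrow> (int ^ 'r) set" where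
  "half_solutions Y b =
     {s. (\<forall>t. 0 \<le> s $ t \<and> s $ t \<le> mult Y b $ t) \<and>
         (\<Sum>t\<in>UNIV. of_int (s $ t) *\<^sub>R b t) = (1 / 2) *\<^sub>R col_total Y b}"

definition active :: "real ^ 'n ^ 'd \<Rightarrow> ('r::finite \<Rightarrow> real ^ 'd) \<Rightarrow> 'r set" where
  "active Y b = {t. \<exists>s\<in>half_solutions Y b. 0 < s $ t \<and> s $ t < mult Y b $ t}"

definition Qspace :: "real ^ 'n ^ 'd \<Rightarrow> ('r::finite \<Rightarrow> real ^ 'd) \<Rightarrow> (real ^ 'r) set" where
  "Qspace Y b =
     span {(\<chi> t. real_of_int (mult Y b $ t - 2 * s $ t)) | s. s \<in> half_solutions Y b}"

end

theory Submission
  imports Defs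
begin

text \<open>Let \<open>c\<close> send a position \<open>j\<close> to the index of the \<open>j\<close>-th column among the distinct columns, and
  let \<open>P\<close> be the linear map that sums the entries of a vector over each fibre of \<open>c\<close>. Since
  \<open>Y x = \<Sum>\<^sub>t (P x)\<^sub>t b\<^sub>t\<close>, the kernel of \<open>Y\<close> is the preimage under \<open>P\<close> of the space of relations
  among the \<open>b\<^sub>t\<close>. A sign vector with \<open>s\<^sub>t\<close> entries \<open>-1\<close> on the fibre over \<open>t\<close> has image \<open>m - 2s\<close>, and
  every \<open>s\<close> with \<open>0 \<le> s \<le> m\<close> comes from some sign vector; hence \<open>P\<close> maps the span \<open>W\<close> of the sign
  vectors in \<open>ker Y\<close> onto \<open>Q\<close> (\<open>fibre_sum_image_span_sign\<close>).

  What \<open>W\<close> contains inside \<open>ker P\<close> is decided fibre by fibre. On the fibre over an active \<open>t\<close> some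
  sign vector in \<open>ker Y\<close> takes both signs, at positions that may be chosen freely. Exchanging two
  opposite entries leaves \<open>Y x\<close> unchanged, so the difference \<open>e\<^sub>i - e\<^sub>j\<close> of any two unit vectors of
  that fibre lies in \<open>W\<close>. On the fibre over an inactive \<open>t\<close> all sign vectors in \<open>ker Y\<close> are constant,
  so an element of \<open>W\<close> whose sum over that fibre is \<open>0\<close> vanishes there. Therefore \<open>W \<inter> ker P\<close> consists
  of the vectors that have all fibre sums \<open>0\<close> and are supported on active fibres
  (\<open>span_sign_inter_fibre_sum_kernel\<close>), a space of dimension \<open>\<Sum> (m\<^sub>t - 1)\<close> over the active \<open>t\<close>. The
  dimension formula is then rank-nullity for \<open>P\<close> on \<open>W\<close>, and the criterion compares images and
  kernels of \<open>P\<close> on \<open>W \<subseteq> ker Y\<close>.\<close>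

section \<open>Rank-nullity on a subspace\<close>

text \<open>The map is injective on the orthogonal complement in \<open>W\<close> of its kernel, and that complement
  already has the full image.\<close>

lemma dim_image_plus_dim_kernel:
  fixes f :: "'a::euclidean_space \<Rightarrow> 'b::euclidean_space"
  assumes f: "linear f" and W: "subspace W"
  shows "dim W = dim (f ` W) + dim {x \<in> W. f x = 0}"
proof -
  interpret linear f by (rule f)
  define N where "N = {x \<in> W. f x = 0}"
  define C where "C = {y \<in> W. \<forall>x\<in>N. orthogonal x y}"
  have N: "subspace N"
    using W by (auto simp: N_def subspace_def add scale)
  have C: "subspace C"
    using W by (auto simp: C_def subspace_def orthogonal_clauses)
  have "N \<subseteq> W"
    by (auto simp: N_def)
  then have dims: "dim C + dim N = dim W"
    unfolding C_def using dim_subspace_orthogonal_to_vectors[OF N W] by blast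
  have "inj_on f C"
  proof (rule inj_onI)
    fix x y assume "x \<in> C" "y \<in> C" "f x = f y"
    then have "x - y \<in> C" "x - y \<in> N"
      using subspace_diff[OF C] subspace_diff[OF W] by (auto simp: N_def C_def diff)
    then have "orthogonal (x - y) (x - y)"
      by (auto simp: C_def)
    then show "x = y"
      by (simp add: orthogonal_self)
  qed
  moreover have "span C = C"
    using C by (simp add: span_eq_iff)
  ultimately have "dim (f ` C) = dim C"
    using dim_image_eq[OF f, of C] by metis
  moreover have "f ` C = f ` W"
  proof
    show "f ` C \<subseteq> f ` W"
      by (auto simp: C_def)
    show "f ` W \<subseteq> f ` C"
    proof
      fix u assume "u \<in> f ` W"
      then obtain w where w: "w \<in> W" "u = f w" by blast
      obtain y z where y: "y \<in> span N" and z: "\<And>v. v \<in> span N \<Longrightarrow> orthogonal z v"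
          and wyz: "w = y + z"
        using orthogonal_subspace_decomp_exists by blast
      have "y \<in> N"
        using y N by (metis span_eq_iff)
      moreover have "z = w - y"
        using wyz by simp
      ultimately have "z \<in> W" "f z = u"
        using w subspace_diff[OF W] by (auto simp: N_def diff)
      moreover from this have "z \<in> C"
        using z by (auto simp: C_def orthogonal_commute span_base)
      ultimately show "u \<in> f ` C" by blast
    qed
  qed
  ultimately show ?thesis
    using dims by (simp add: N_def)
qed

section \<open>Sums over the fibres of a map between index sets\<close>

definition fibre_sum :: "('n \<Rightarrow> 'r) \<Rightarrow> real ^ 'n \<Rightarrow> real ^ 'r" where
  "fibre_sum c x = (\<chi> t. \<Sum>j | c j = t. x $ j)"

lemma linear_fibre_sum: "linear (fibre_sum c)"
  by (rule linearI) (simp_all add: fibre_sum_def vec_eq_iff sum.distrib sum_distrib_left)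

lemma fibre_sum_axis_diff:
  assumes "c i = c j"
  shows "fibre_sum c (axis i 1 - axis j 1) = 0"
  using assms by (auto simp: fibre_sum_def vec_eq_iff axis_def sum_subtractf sum.delta)

text \<open>Placing each prescribed sum at one chosen point of its fibre shows that nothing is lost in the
  image, also when the support is restricted to some of the fibres.\<close>

lemma fibre_sum_onto_supported:
  fixes c :: "'n::finite \<Rightarrow> 'r::finite"
  assumes "surj c"
  shows "fibre_sum c ` {x. \<forall>j. c j \<notin> A \<longrightarrow> x $ j = 0} = {z. \<forall>t. t \<notin> A \<longrightarrow> z $ t = 0}"
proof
  show "fibre_sum c ` {x. \<forall>j. c j \<notin> A \<longrightarrow> x $ j = 0} \<subseteq> {z. \<forall>t. t \<notin> A \<longrightarrow> z $ t = 0}"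
    by (auto simp: fibre_sum_def intro!: sum.neutral)
  show "{z. \<forall>t. t \<notin> A \<longrightarrow> z $ t = 0} \<subseteq> fibre_sum c ` {x. \<forall>j. c j \<notin> A \<longrightarrow> x $ j = 0}"
  proof
    fix z :: "real ^ 'r" assume z: "z \<in> {z. \<forall>t. t \<notin> A \<longrightarrow> z $ t = 0}"
    define x :: "real ^ 'n" where "x = (\<chi> j. if j = inv c (c j) then z $ c j else 0)"
    have "(\<Sum>j | c j = t. x $ j) = z $ t" for t
    proof -
      have "(\<Sum>j | c j = t. x $ j) = (\<Sum>j | c j = t. if j = inv c t then z $ t else 0)"
        by (rule sum.cong) (auto simp: x_def)
      also have "\<dots> = z $ t"
        using surj_f_inv_f[OF assms, of t] by (simp add: sum.delta')
      finally show ?thesis .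
    qed
    then have "fibre_sum c x = z"
      by (simp add: fibre_sum_def vec_eq_iff)
    moreover have "\<forall>j. c j \<notin> A \<longrightarrow> x $ j = 0"
      using z by (simp add: x_def)
    ultimately show "z \<in> fibre_sum c ` {x. \<forall>j. c j \<notin> A \<longrightarrow> x $ j = 0}"
      by blast
  qed
qed

lemma dim_supported: "dim {x :: real ^ 'n. \<forall>j. P j \<longrightarrow> x $ j = 0} = card {j. \<not> P j}"
  using dim_substandard_cart[where 'a = real and d = "{j. \<not> P j}"] by (simp add: dim_vec_eq)

text \<open>Rank-nullity for the fibre sums on the vectors supported over \<open>A\<close>.\<close>

lemma dim_fibre_sum_kernel_supported:
  fixes c :: "'n::finite \<Rightarrow> 'r::finite"
  assumes "surj c"
  shows "int (dim {x :: real ^ 'n. (\<forall>j. c j \<notin> A \<longrightarrow> x $ j = 0) \<and> fibre_sum c x = 0}) =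
    (\<Sum>t\<in>A. int (card {j. c j = t}) - 1)"
proof -
  let ?E = "{x :: real ^ 'n. \<forall>j. c j \<notin> A \<longrightarrow> x $ j = 0}"
  let ?D = "{x :: real ^ 'n. (\<forall>j. c j \<notin> A \<longrightarrow> x $ j = 0) \<and> fibre_sum c x = 0}"
  have "subspace ?E"
    by (auto simp: subspace_def)
  then have "dim ?E = dim (fibre_sum c ` ?E) + dim {x \<in> ?E. fibre_sum c x = 0}"
    by (rule dim_image_plus_dim_kernel[OF linear_fibre_sum])
  then have "card {j. c j \<in> A} = card A + dim ?D"
    by (simp add: fibre_sum_onto_supported[OF assms] dim_supported)
  moreover have "card {j. c j \<in> A} = (\<Sum>t\<in>A. card {j. c j = t})"
  proof -
    have "{j. c j \<in> A} = (\<Union>t\<in>A. {j. c j = t})" by auto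
    then show ?thesis
      by (simp only:) (rule card_UN_disjoint; auto)
  qed
  ultimately show ?thesis
    by (simp add: sum_subtractf flip: of_nat_sum)
qed

text \<open>Moving all the mass of a fibre to one representative decomposes a vector with vanishing fibre
  sums into differences of unit vectors.\<close>

lemma fibre_sum_kernel_mem:
  fixes x :: "real ^ 'n" and c :: "'n \<Rightarrow> 'r::finite"
  assumes W: "subspace W" and x: "fibre_sum c x = 0"
    and diff: "\<And>i j. c i = c j \<Longrightarrow> x $ i \<noteq> 0 \<Longrightarrow> axis i 1 - axis j 1 \<in> W"
  shows "x \<in> W"
proof -
  define r where "r t = (SOME j. c j = t)" for t
  have r: "c (r (c j)) = c j" for j
    unfolding r_def by (rule someI) simp
  have "(\<Sum>j\<in>UNIV. x $ j *\<^sub>R (axis (r (c j)) 1 :: real ^ 'n)) =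
      (\<Sum>t\<in>UNIV. \<Sum>j | j \<in> UNIV \<and> c j = t. x $ j *\<^sub>R axis (r (c j)) 1)"
    by (rule sum.group[symmetric]) auto
  also have "\<dots> = (\<Sum>t\<in>UNIV. (\<Sum>j | c j = t. x $ j) *\<^sub>R axis (r t) 1)"
    by (auto simp: scaleR_sum_left intro!: sum.cong)
  also have "\<dots> = 0"
    using x by (simp add: fibre_sum_def vec_eq_iff)
  finally have "x = (\<Sum>j\<in>UNIV. x $ j *\<^sub>R (axis j 1 - axis (r (c j)) 1))"
    using basis_expansion[of x]
    by (simp add: scaleR_diff_right sum_subtractf scalar_mult_eq_scaleR)
  also have "\<dots> \<in> W"
  proof (rule subspace_sum[OF W])
    fix j
    show "x $ j *\<^sub>R (axis j 1 - axis (r (c j)) 1) \<in> W"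
      using diff[of j "r (c j)"] r[of j] subspace_scale[OF W] subspace_0[OF W]
      by (cases "x $ j = 0") auto
  qed
  finally show ?thesis .
qed

section \<open>Sign vectors and how often they are negative on each fibre\<close>

definition neg_count :: "('n \<Rightarrow> 'r) \<Rightarrow> real ^ 'n \<Rightarrow> int ^ 'r" where
  "neg_count c x = (\<chi> t. int (card {j. c j = t \<and> x $ j = - 1}))"

lemma sign_vectors_entry: "x \<in> sign_vectors \<Longrightarrow> x $ j = 1 \<or> x $ j = - 1"
  by (auto simp: sign_vectors_def)

lemma fibre_sum_sign:
  assumes "x \<in> sign_vectors"
  shows "fibre_sum c x $ t = real (card {j. c j = t}) - 2 * real_of_int (neg_count c x $ t)"
proof -
  have "fibre_sum c x $ t = (\<Sum>j | c j = t. 1 - 2 * (if x $ j = - 1 then 1 else 0))"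
    using sign_vectors_entry[OF assms] by (force simp: fibre_sum_def intro!: sum.cong)
  also have "\<dots> = real (card {j. c j = t}) - 2 * real (card {j \<in> {j. c j = t}. x $ j = - 1})"
    by (simp add: sum_subtractf sum_distrib_left[symmetric] sum.If_cases Int_def)
  finally show ?thesis
    by (simp add: neg_count_def)
qed

lemma ex_sign_vector_neg_count:
  fixes c :: "'n::finite \<Rightarrow> 'r::finite"
  assumes "\<And>t. 0 \<le> s $ t \<and> s $ t \<le> int (card {j. c j = t})"
  obtains x :: "real ^ 'n" where "x \<in> sign_vectors" "neg_count c x = s"
proof -
  have "\<exists>N. N \<subseteq> {j. c j = t} \<and> card N = nat (s $ t)" for t
    using obtain_subset_with_card_n[of "nat (s $ t)" "{j. c j = t}"] assms[of t]
    by (metis nat_le_iff)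
  then obtain N where N: "\<And>t. N t \<subseteq> {j. c j = t}" "\<And>t. card (N t) = nat (s $ t)"
    by metis
  define x :: "real ^ 'n" where "x = (\<chi> j. if j \<in> N (c j) then - 1 else 1)"
  have "{j. c j = t \<and> x $ j = - 1} = N t" for t
    using N(1)[of t] by (auto simp: x_def)
  then have "neg_count c x = s"
    using N(2) assms by (simp add: neg_count_def vec_eq_iff)
  moreover have "x \<in> sign_vectors"
    by (simp add: sign_vectors_def x_def)
  ultimately show ?thesis using that by blast
qed

text \<open>Fibre sums depend only on the number of negative entries in each fibre, so the negative
  positions of \<open>x\<close> in the fibre of \<open>i\<close> may be moved: \<open>j\<close> becomes one of them, and the others fit
  outside \<open>{i, j}\<close> because at least one entry of the fibre is positive.\<close>

lemma ex_sign_vector_opposite: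
  fixes c :: "'n::finite \<Rightarrow> 'r::finite"
  assumes x: "x \<in> sign_vectors" and ij: "c i = c j" "i \<noteq> j"
    and mixed: "0 < neg_count c x $ c i" "neg_count c x $ c i < int (card {k. c k = c i})"
  obtains y :: "real ^ 'n" where "y \<in> sign_vectors" "fibre_sum c y = fibre_sum c x"
    "y $ i = 1" "y $ j = - 1"
proof -
  let ?n = "nat (neg_count c x $ c i)" and ?F = "{k. c k = c i}"
  have "?n - 1 \<le> card (?F - {i, j})"
    using mixed ij by (simp add: card_Diff_subset)
  then obtain N where N: "N \<subseteq> ?F - {i, j}" "card N = ?n - 1"
    using obtain_subset_with_card_n by metis
  define y :: "real ^ 'n" where
    "y = (\<chi> k. if c k = c i then if k \<in> insert j N then - 1 else 1 else x $ k)"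
  have y: "y \<in> sign_vectors"
    using sign_vectors_entry[OF x] by (auto simp: sign_vectors_def y_def)
  have "neg_count c y $ t = neg_count c x $ t" for t
  proof (cases "t = c i")
    case True
    have "{k. c k = c i \<and> y $ k = - 1} = insert j N"
      using N(1) ij by (auto simp: y_def)
    moreover have "card (insert j N) = ?n"
      using N mixed by (subst card_insert_disjoint) auto
    ultimately show ?thesis
      using True mixed by (simp add: neg_count_def)
  next
    case False
    then have "{k. c k = t \<and> y $ k = - 1} = {k. c k = t \<and> x $ k = - 1}"
      by (auto simp: y_def)
    then show ?thesis by (simp add: neg_count_def)
  qed
  then have "fibre_sum c y = fibre_sum c x"
    by (simp add: vec_eq_iff fibre_sum_sign[OF x] fibre_sum_sign[OF y])
  moreover have "y $ i = 1" "y $ j = - 1"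
    using N(1) ij by (auto simp: y_def)
  ultimately show ?thesis using y that by blast
qed

lemma sign_vector_constant_on_fibre:
  fixes c :: "'n::finite \<Rightarrow> 'r::finite"
  assumes x: "x \<in> sign_vectors"
    and pure: "\<not> (0 < neg_count c x $ c i \<and> neg_count c x $ c i < int (card {k. c k = c i}))"
    and "c i = c j"
  shows "x $ i = x $ j"
proof (rule ccontr)
  assume "x $ i \<noteq> x $ j"
  then obtain p q where pq: "c p = c i" "c q = c i" "x $ p = - 1" "x $ q = 1"
    using sign_vectors_entry[OF x, of i] sign_vectors_entry[OF x, of j] \<open>c i = c j\<close> by metis
  let ?N = "{k. c k = c i \<and> x $ k = - 1}"
  have "?N \<noteq> {}" using pq by blast
  moreover have "?N \<subset> {k. c k = c i}"
    using pq by force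
  ultimately show False
    using pure psubset_card_mono[of "{k. c k = c i}" ?N]
    by (simp add: neg_count_def card_gt_0_iff)
qed

section \<open>The fibres of equal columns\<close>

definition relations :: "('r::finite \<Rightarrow> real ^ 'd) \<Rightarrow> (real ^ 'r) set" where
  "relations b = {z. (\<Sum>t\<in>UNIV. z $ t *\<^sub>R b t) = 0}"

locale column_labelling =
  fixes Y :: "real ^ 'n ^ 'd" and b :: "'r::finite \<Rightarrow> real ^ 'd" and c :: "'n \<Rightarrow> 'r"
  assumes inj_b: "inj b" and surj_c: "surj c" and column_eq: "column j Y = b (c j)"
begin

abbreviation W :: "(real ^ 'n) set" where
  "W \<equiv> span (kernel Y \<inter> sign_vectors)"

lemma mult_nth: "mult Y b $ t = int (card {j. c j = t})"
  using inj_b by (simp add: mult_def column_eq inj_eq)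

lemma mult_vec_fibre_sum: "Y *v x = (\<Sum>t\<in>UNIV. fibre_sum c x $ t *\<^sub>R b t)"
proof -
  have "Y *v x = (\<Sum>j\<in>UNIV. x $ j *\<^sub>R b (c j))"
    by (simp add: matrix_mult_sum scalar_mult_eq_scaleR column_eq)
  also have "\<dots> = (\<Sum>t\<in>UNIV. \<Sum>j | j \<in> UNIV \<and> c j = t. x $ j *\<^sub>R b (c j))"
    by (rule sum.group[symmetric]) auto
  also have "\<dots> = (\<Sum>t\<in>UNIV. fibre_sum c x $ t *\<^sub>R b t)"
    by (auto simp: fibre_sum_def scaleR_sum_left intro!: sum.cong)
  finally show ?thesis .
qed

lemma kernel_iff_relations: "x \<in> kernel Y \<longleftrightarrow> fibre_sum c x \<in> relations b"
  by (simp add: kernel_def relations_def mult_vec_fibre_sum)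

lemma subspace_kernel: "subspace (kernel Y)"
  by (auto simp: kernel_def subspace_def matrix_vector_right_distrib matrix_vector_mult_scaleR)

lemma span_sign_subset_kernel: "W \<subseteq> kernel Y"
  by (simp add: span_minimal subspace_kernel)

lemma fibre_sum_sign_eq:
  assumes "x \<in> sign_vectors"
  shows "fibre_sum c x = (\<chi> t. real_of_int (mult Y b $ t - 2 * neg_count c x $ t))"
  by (simp add: vec_eq_iff fibre_sum_sign[OF assms] mult_nth)

lemma neg_count_half_solution_iff:
  assumes x: "x \<in> sign_vectors"
  shows "neg_count c x \<in> half_solutions Y b \<longleftrightarrow> x \<in> kernel Y"
proof -
  have "0 \<le> neg_count c x $ t \<and> neg_count c x $ t \<le> mult Y b $ t" for t
    by (auto simp: neg_count_def mult_nth intro!: card_mono)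
  moreover have "Y *v x =
      col_total Y b - 2 *\<^sub>R (\<Sum>t\<in>UNIV. of_int (neg_count c x $ t) *\<^sub>R b t)"
    by (simp add: mult_vec_fibre_sum fibre_sum_sign_eq[OF x] col_total_def scaleR_diff_left
        sum_subtractf scaleR_sum_right)
  moreover have "u - 2 *\<^sub>R v = 0 \<longleftrightarrow> v = (1 / 2) *\<^sub>R u" for u v :: "real ^ 'd"
    by (simp add: vec_eq_iff) (metis mult.commute)
  ultimately show ?thesis
    by (simp add: half_solutions_def kernel_def)
qed

lemma half_solution_realised:
  assumes "s \<in> half_solutions Y b"
  obtains x where "x \<in> kernel Y \<inter> sign_vectors" "neg_count c x = s"
proof -
  have "0 \<le> s $ t \<and> s $ t \<le> int (card {j. c j = t})" for t
    using assms by (simp add: half_solutions_def mult_nth)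
  then obtain x :: "real ^ 'n" where "x \<in> sign_vectors" "neg_count c x = s"
    using ex_sign_vector_neg_count by metis
  then show ?thesis
    using that assms neg_count_half_solution_iff by blast
qed

lemma fibre_sum_image_span_sign: "fibre_sum c ` W = Qspace Y b"
proof -
  have "fibre_sum c ` (kernel Y \<inter> sign_vectors) =
      {(\<chi> t. real_of_int (mult Y b $ t - 2 * s $ t)) | s. s \<in> half_solutions Y b}"
    (is "?L = ?R")
  proof
    show "?L \<subseteq> ?R"
      using fibre_sum_sign_eq neg_count_half_solution_iff by blast
    show "?R \<subseteq> ?L"
    proof
      fix z assume "z \<in> ?R"
      then obtain s where s: "s \<in> half_solutions Y b"
          and z: "z = (\<chi> t. real_of_int (mult Y b $ t - 2 * s $ t))" by blast
      obtain x where "x \<in> kernel Y \<inter> sign_vectors" "neg_count c x = s"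
        using half_solution_realised[OF s] .
      then show "z \<in> ?L"
        using fibre_sum_sign_eq[of x] z by (intro image_eqI[of _ _ x]) auto
    qed
  qed
  then show ?thesis
    by (simp only: Qspace_def linear_span_image[OF linear_fibre_sum, symmetric])
qed

text \<open>Two sign vectors of the kernel that differ only by exchanging opposite entries at \<open>i\<close> and \<open>j\<close>
  have difference \<open>2 (e\<^sub>i - e\<^sub>j)\<close>.\<close>

lemma axis_diff_in_span_sign:
  assumes "c i = c j" "c i \<in> active Y b"
  shows "axis i 1 - axis j 1 \<in> W"
proof (cases "i = j")
  case False
  obtain s where s: "s \<in> half_solutions Y b" "0 < s $ c i" "s $ c i < mult Y b $ c i"
    using assms(2) by (auto simp: active_def)
  obtain x where x: "x \<in> kernel Y \<inter> sign_vectors" "neg_count c x = s"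
    using half_solution_realised[OF s(1)] .
  obtain y where y: "y \<in> sign_vectors" "fibre_sum c y = fibre_sum c x" "y $ i = 1" "y $ j = - 1"
    using ex_sign_vector_opposite[of x c i j] x s assms(1) False by (auto simp: mult_nth)
  define y' where "y' = y - 2 *\<^sub>R (axis i 1 - axis j 1)"
  have "y' $ k = (if k = i then - 1 else if k = j then 1 else y $ k)" for k
    using y False by (auto simp: y'_def axis_def)
  then have "y' \<in> sign_vectors"
    using y(1) by (auto simp: sign_vectors_def)
  moreover have "fibre_sum c y' = fibre_sum c x"
    using y(2) fibre_sum_axis_diff[of c i j] assms(1) unfolding y'_def
    by (simp add: linear_diff[OF linear_fibre_sum] linear_scale[OF linear_fibre_sum])
  ultimately have "y \<in> W" "y' \<in> W"
    using x y by (auto intro!: span_base simp: kernel_iff_relations)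
  then have "(1 / 2) *\<^sub>R (y - y') \<in> W"
    by (intro span_scale span_diff)
  then show ?thesis
    by (simp add: y'_def)
qed (simp add: span_zero)

text \<open>Every half solution is \<open>0\<close> or \<open>m\<^sub>t\<close> at an inactive \<open>t\<close>, so each sign vector of the kernel is
  constant on that fibre, and constancy passes to the span.\<close>

lemma span_sign_constant_on_inactive:
  assumes "x \<in> W" "c i = c j" "c i \<notin> active Y b"
  shows "x $ i = x $ j"
proof -
  have "subspace {x :: real ^ 'n. x $ i = x $ j}"
    by (auto simp: subspace_def)
  moreover have "kernel Y \<inter> sign_vectors \<subseteq> {x. x $ i = x $ j}"
  proof
    fix x assume x: "x \<in> kernel Y \<inter> sign_vectors"
    then have "neg_count c x \<in> half_solutions Y b"
      by (simp add: neg_count_half_solution_iff)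
    then have "\<not> (0 < neg_count c x $ c i \<and> neg_count c x $ c i < int (card {k. c k = c i}))"
      using assms(3) by (auto simp: active_def mult_nth)
    then show "x \<in> {x. x $ i = x $ j}"
      using sign_vector_constant_on_fibre x assms(2) by blast
  qed
  ultimately show ?thesis
    using span_minimal assms(1) by blast
qed

text \<open>On an inactive fibre a constant entry with vanishing sum is \<open>0\<close>; the active fibres contribute all
  differences of their unit vectors.\<close>

lemma span_sign_inter_fibre_sum_kernel:
  "{x \<in> W. fibre_sum c x = 0} =
    {x. (\<forall>j. c j \<notin> active Y b \<longrightarrow> x $ j = 0) \<and> fibre_sum c x = 0}"
proof -
  have "x $ j = 0" if x: "x \<in> W" "fibre_sum c x = 0" and j: "c j \<notin> active Y b" for x j
  proof -
    have "(\<Sum>k | c k = c j. x $ k) = (\<Sum>k | c k = c j. x $ j)"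
    proof (rule sum.cong[OF refl])
      fix k assume "k \<in> {k. c k = c j}"
      then show "x $ k = x $ j"
        using span_sign_constant_on_inactive[OF x(1), of k j] j by simp
    qed
    moreover have "(\<Sum>k | c k = c j. x $ k) = 0"
      using x(2) by (simp add: fibre_sum_def vec_eq_iff)
    ultimately show ?thesis
      by (auto simp: card_eq_0_iff)
  qed
  moreover have "x \<in> W"
    if "\<forall>j. c j \<notin> active Y b \<longrightarrow> x $ j = 0" "fibre_sum c x = 0" for x
    using that by (intro fibre_sum_kernel_mem[of W c x] axis_diff_in_span_sign) (auto, metis)
  ultimately show ?thesis by blast
qed

lemma sigma_eq: "int (sigma Y) = (\<Sum>t\<in>active Y b. mult Y b $ t - 1) + int (dim (Qspace Y b))"
proof -
  have "dim W = dim (fibre_sum c ` W) + dim {x \<in> W. fibre_sum c x = 0}"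
    by (rule dim_image_plus_dim_kernel[OF linear_fibre_sum subspace_span])
  then show ?thesis
    using dim_fibre_sum_kernel_supported[OF surj_c, of "active Y b"]
    by (simp add: sigma_def fibre_sum_image_span_sign span_sign_inter_fibre_sum_kernel mult_nth)
qed

lemma fibre_sum_image_kernel: "fibre_sum c ` kernel Y = relations b"
proof
  show "fibre_sum c ` kernel Y \<subseteq> relations b"
    using kernel_iff_relations by blast
  show "relations b \<subseteq> fibre_sum c ` kernel Y"
  proof
    fix z assume z: "z \<in> relations b"
    have "surj (fibre_sum c :: real ^ 'n \<Rightarrow> real ^ 'r)"
      using fibre_sum_onto_supported[OF surj_c, of UNIV] by simp
    then obtain x where "z = fibre_sum c x"
      by (rule surjE)
    then show "z \<in> fibre_sum c ` kernel Y"
      using z kernel_iff_relations by blast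
  qed
qed

text \<open>The two conditions compare \<open>W\<close> with \<open>ker Y\<close> on the image and on the kernel of the fibre sums:
  the images are \<open>Q\<close> and the space of relations, while \<open>ker Y\<close> contains all vectors with vanishing
  fibre sums and \<open>W\<close> only those supported on active fibres.\<close>

lemma span_sign_eq_kernel_iff:
  "W = kernel Y \<longleftrightarrow>
    (\<forall>t. mult Y b $ t \<ge> 2 \<longrightarrow> t \<in> active Y b) \<and> Qspace Y b = relations b"
proof (intro iffI conjI allI impI)
  assume eq: "W = kernel Y"
  then show "Qspace Y b = relations b"
    using fibre_sum_image_span_sign fibre_sum_image_kernel by simp
  fix t assume "mult Y b $ t \<ge> 2"
  then have "\<not> card {j. c j = t} \<le> Suc 0"
    by (simp add: mult_nth)
  then obtain i j where ij: "c i = t" "c j = t" "i \<noteq> j"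
    by (auto simp: card_le_Suc0_iff_eq)
  let ?x = "axis i 1 - axis j 1 :: real ^ 'n"
  have "fibre_sum c ?x = 0"
    using ij by (intro fibre_sum_axis_diff) simp
  moreover from this have "?x \<in> W"
    unfolding eq by (simp add: kernel_iff_relations relations_def)
  ultimately have "c i \<notin> active Y b \<longrightarrow> ?x $ i = 0"
    using span_sign_inter_fibre_sum_kernel by blast
  then show "t \<in> active Y b"
    using ij by (auto simp: axis_def)
next
  assume H: "(\<forall>t. mult Y b $ t \<ge> 2 \<longrightarrow> t \<in> active Y b) \<and> Qspace Y b = relations b"
  have "x \<in> W" if x: "x \<in> kernel Y" for x
  proof -
    have "fibre_sum c x \<in> fibre_sum c ` W"
      using x H by (simp add: fibre_sum_image_span_sign kernel_iff_relations)
    then obtain w where w: "w \<in> W" "fibre_sum c x = fibre_sum c w" by blast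
    have 0: "fibre_sum c (x - w) = 0"
      using w by (simp add: linear_diff[OF linear_fibre_sum])
    moreover have "(x - w) $ j = 0" if "c j \<notin> active Y b" for j
    proof -
      \<comment> \<open>An inactive fibre is a single point, so the entry there is a fibre sum.\<close>
      have "\<not> mult Y b $ c j \<ge> 2"
        using H that by blast
      then have "card {k. c k = c j} \<le> Suc 0"
        by (simp add: mult_nth)
      then have "{k. c k = c j} = {j}"
        by (auto simp: card_le_Suc0_iff_eq)
      moreover have "(\<Sum>k | c k = c j. (x - w) $ k) = 0"
        using 0 by (simp add: fibre_sum_def vec_eq_iff)
      ultimately show ?thesis by simp
    qed
    ultimately have "x - w \<in> W"
      using span_sign_inter_fibre_sum_kernel by blast
    then show ?thesis
      using span_add[OF _ w(1)] by fastforce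
  qed
  then show "W = kernel Y"
    using span_sign_subset_kernel by blast
qed

end

theorem theorem3p2:
  fixes Y :: "real ^ 'n ^ 'd" and b :: "'r::finite \<Rightarrow> real ^ 'd"
  assumes "enumerates_columns Y b"
  shows "int (sigma Y) = (\<Sum>t\<in>active Y b. mult Y b $ t - 1) + int (dim (Qspace Y b)) \<and>
    (span (kernel Y \<inter> sign_vectors) = kernel Y \<longleftrightarrow>
       (\<forall>t. mult Y b $ t \<ge> 2 \<longrightarrow> t \<in> active Y b) \<and>
       Qspace Y b = {z :: real ^ 'r. (\<Sum>t\<in>UNIV. z $ t *\<^sub>R b t) = 0})"
proof -
  have b: "inj b" "range b = columns Y"
    using assms by (simp_all add: enumerates_columns_def bij_betw_def)
  define c where "c j = inv b (column j Y)" for j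
  have col: "column j Y = b (c j)" for j
  proof -
    have "column j Y \<in> range b"
      using b(2) by (auto simp: columns_def)
    then show ?thesis
      by (simp add: c_def f_inv_into_f)
  qed
  have "surj c"
  proof (unfold surj_def, rule allI)
    fix t
    have "b t \<in> columns Y" using b(2) by blast
    then obtain j where "column j Y = b t" by (auto simp: columns_def)
    then show "\<exists>j. t = c j"
      using b(1) by (metis c_def inv_f_f)
  qed
  then interpret column_labelling Y b c
    using b(1) col by unfold_locales
  show ?thesis
    using sigma_eq span_sign_eq_kernel_iff by (simp add: relations_def)
qed

end
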